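(* The local tree-independence number and the layered tree-independence number of hyperbolic uniform disk graphs are unbounded. That is: (a) there is no function $f:\mathbb N\to\mathbb N$ such that for every hyperbolic uniform disk graph $G$, every $v\in V(G)$ and every $t\in\mathbb N$, the subgraph of $G$ induced by the vertices at distance at most $t$ from $v$ has tree-independence number at most $f(t)$; and (b) there is no constant $c$ such that every hyperbolic uniform disk graph has layered tree-independence number at most $c$.
   Context: Graphs are finite and simple. A graph $G$ is a hyperbolic uniform disk graph (HUDG) if there is an $r>0$ such that $G$ is the intersection graph of (closed) disks of radius $r$ in the hyperbolic plane; equivalently, vertices are assigned to points and two distinct vertices are adjacent if and only if their points have hyperbolic distance at most $2r$. The independence number of a vertex set $X\subseteq V(G)$ is the maximum size of an independent set in $G[X]$. The tree-independence number of $G$ is the minimum, over all tree decompositions of $G$, of the maximum independence number of a bag. A layering of $G$ is an ordered partition $(V_0,V_1,\dots)$ of $V(G)$ such that every edge of $G$ has both endpoints in one layer or in two consecutive layers. The layered tree-independence number of $G$ is the smallest $\ell$ such that $G$ has a tree decomposition and a layering for which the intersection of every bag with every layer has independence number at most $\ell$. *)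

theory Defs
  imports Complex_Main "Graph_Theory.Graph_Theory"
begin

section \<open>Finite simple graphs\<close>

text \<open>
  A finite simple graph is a symmetric, loop-free finite digraph without parallel arcs; this is
  the locale \<^locale>\<open>graph\<close>.  The library's predicate \<^const>\<open>tree\<close> forbids all directed cycles,
  hence also the cycle \<open>a, b, a\<close> that every edge of a symmetric digraph gives rise to.  For such
  digraphs the cycles of the undirected graph are the directed cycles of length at least 3.
\<close>

definition undirected_tree :: "('t, 'e) pre_digraph \<Rightarrow> bool" where
  "undirected_tree T \<longleftrightarrow>
     graph T \<and> connected T \<and> \<not> (\<exists>p. pre_digraph.cycle T p \<and> length p \<ge> 3)"

definition graph_dist :: "('a, 'b) pre_digraph \<Rightarrow> 'a \<Rightarrow> 'a \<Rightarrow> ereal" where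
  "graph_dist G u v = wf_digraph.\<mu> G (\<lambda>_. 1) u v"

definition graph_ball :: "('a, 'b) pre_digraph \<Rightarrow> 'a \<Rightarrow> nat \<Rightarrow> 'a set" where
  "graph_ball G v t = {u \<in> verts G. graph_dist G v u \<le> ereal (real t)}"

definition independent_set :: "('a, 'b) pre_digraph \<Rightarrow> 'a set \<Rightarrow> bool" where
  "independent_set G S \<longleftrightarrow> S \<subseteq> verts G \<and> (\<forall>u\<in>S. \<forall>v\<in>S. u \<noteq> v \<longrightarrow> \<not> u \<rightarrow>\<^bsub>G\<^esub> v)"

definition independence_number :: "('a, 'b) pre_digraph \<Rightarrow> 'a set \<Rightarrow> nat" where
  "independence_number G X = Max {card S | S. independent_set (G \<restriction> X) S}"


section \<open>Tree decompositions and layerings\<close>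

definition tree_decomposition ::
  "('a, 'b) pre_digraph \<Rightarrow> ('t, 'e) pre_digraph \<Rightarrow> ('t \<Rightarrow> 'a set) \<Rightarrow> bool" where
  "tree_decomposition G T B \<longleftrightarrow>
     undirected_tree T \<and>
     (\<Union>t\<in>verts T. B t) = verts G \<and>
     (\<forall>u v. u \<rightarrow>\<^bsub>G\<^esub> v \<longrightarrow> (\<exists>t\<in>verts T. u \<in> B t \<and> v \<in> B t)) \<and>
     (\<forall>v\<in>verts G. connected (T \<restriction> {t \<in> verts T. v \<in> B t}))"

text \<open>
  Decomposition trees are finite, so natural numbers suffice as names for their nodes.  A finite
  graph always has a tree decomposition (with a single bag), so the infimum and the least
  element below are taken over non-empty sets.
\<close>

definition tree_independence_number :: "('a, 'b) pre_digraph \<Rightarrow> nat" where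
  "tree_independence_number G =
     Inf {Max ((\<lambda>t. independence_number G (B t)) ` verts T) | (T :: (nat, nat \<times> nat) pre_digraph) B.
          tree_decomposition G T B}"

text \<open>
  Layers may be empty.  This makes it possible to index them by all natural numbers, and
  dropping the empty layers of a layering yields a layering again.
\<close>

definition layering :: "('a, 'b) pre_digraph \<Rightarrow> (nat \<Rightarrow> 'a set) \<Rightarrow> bool" where
  "layering G L \<longleftrightarrow>
     (\<Union>i. L i) = verts G \<and>
     (\<forall>i j. i \<noteq> j \<longrightarrow> L i \<inter> L j = {}) \<and>
     (\<forall>u v i j. u \<rightarrow>\<^bsub>G\<^esub> v \<and> u \<in> L i \<and> v \<in> L j \<longrightarrow> i = j \<or> i = Suc j \<or> j = Suc i)"

definition layered_tree_independence_number :: "('a, 'b) pre_digraph \<Rightarrow> nat" where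
  "layered_tree_independence_number G =
     (LEAST l. \<exists>(T :: (nat, nat \<times> nat) pre_digraph) B L.
        tree_decomposition G T B \<and> layering G L \<and>
        (\<forall>t\<in>verts T. \<forall>i. independence_number G (B t \<inter> L i) \<le> l))"


section \<open>Hyperbolic uniform disk graphs\<close>

text \<open>The hyperbolic plane of curvature \<open>-1\<close>, in the Poincare upper half-plane model.\<close>

definition hyperbolic_plane :: "complex set" where
  "hyperbolic_plane = {z. Im z > 0}"

definition hyperbolic_dist :: "complex \<Rightarrow> complex \<Rightarrow> real" where
  "hyperbolic_dist z w = arcosh (1 + (cmod (z - w))\<^sup>2 / (2 * Im z * Im w))"

definition hyperbolic_disk :: "complex \<Rightarrow> real \<Rightarrow> complex set" where
  "hyperbolic_disk c r = {z \<in> hyperbolic_plane. hyperbolic_dist c z \<le> r}"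

text \<open>Distinct vertices may be represented by the same disk.\<close>

definition hyperbolic_uniform_disk_graph :: "('a, 'b) pre_digraph \<Rightarrow> bool" where
  "hyperbolic_uniform_disk_graph G \<longleftrightarrow>
     graph G \<and>
     (\<exists>r>0. \<exists>c. c ` verts G \<subseteq> hyperbolic_plane \<and>
        (\<forall>u\<in>verts G. \<forall>v\<in>verts G. u \<noteq> v \<longrightarrow>
           (u \<rightarrow>\<^bsub>G\<^esub> v \<longleftrightarrow> hyperbolic_disk (c u) r \<inter> hyperbolic_disk (c v) r \<noteq> {})))"

end

theory Submission
  imports Defs "HOL-Library.Nat_Bijection" "HOL-Analysis.Elementary_Metric_Spaces"
begin

text \<open>
  Both parts are witnessed by the same graphs.  For each \<open>k\<close> there is a hyperbolic uniform disk graph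
  with a vertex adjacent to all others such that, in every tree decomposition, some bag contains an
  independent set of size \<open>k\<close>.  The ball of radius 1 around that vertex is the whole graph, which
  refutes any function for the local parameter at \<open>t = 1\<close>.  In any layering the whole graph occupies
  at most three consecutive layers, so one of them contains a third of that independent set.

  In the upper half-plane, as the radius grows and all heights shrink accordingly, adjacency
  of the points \<open>(x, s)\<close> and \<open>(y, s')\<close> approaches the condition \<open>(x - y)\<^sup>2 \<le> s * s'\<close>, in suitable units of
  height (lemma \<open>window_graph_hyperbolic\<close> makes this exact).  The points with integer \<open>x\<close>
  between \<open>0\<close> and \<open>64 ^ k\<close> and with \<open>s = 64 ^ j\<close> for \<open>j < k\<close> form a grid, and a very high point, the
  hub, is adjacent to all of them.

  A tree decomposition of any graph has a bag that meets all members of a given bramble, that is,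
  of a family of connected, pairwise touching vertex sets (lemma \<open>bramble_covered_by_bag\<close>, by the
  Helly property of subtrees).  The connected sets that lead from the left end of the grid to its
  right end form a bramble: no such set can jump over a vertex that is at least as high as all its
  members without touching it (lemma \<open>crossings_touch\<close>).  So some bag separates the two ends.  Such a
  bag must be thick: on each level \<open>j\<close>, next to the last vertex reachable from the left, it
  contains all \<open>64 ^ j\<close> points that this vertex could reach
  (lemma \<open>hitting_set_contains_interval\<close>).  The point of level \<open>j\<close> can be chosen in this interval
  away from those already chosen on lower levels, since the latter exclude only a
  fraction of the interval (lemma \<open>far_choice\<close>).  One point per level yields the independent set.
\<close>

section \<open>Brambles and tree decompositions\<close>

text \<open>
  Connectedness in terms of cuts instead of walks.  It passes to the set of tree nodes whose bags
  meet a connected set, and survives the removal of a leaf, without any surgery on walks.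
\<close>

definition cut_connected :: "('a \<Rightarrow> 'a \<Rightarrow> bool) \<Rightarrow> 'a set \<Rightarrow> bool" where
  "cut_connected E X \<longleftrightarrow>
     X \<noteq> {} \<and> (\<forall>A. A \<subset> X \<longrightarrow> A \<noteq> {} \<longrightarrow> (\<exists>a\<in>A. \<exists>b\<in>X - A. E a b))"

lemma cut_connected_nonempty: "cut_connected E X \<Longrightarrow> X \<noteq> {}"
  unfolding cut_connected_def by blast

lemma cut_connectedD:
  assumes "cut_connected E X" "A \<subset> X" "A \<noteq> {}"
  obtains a b where "a \<in> A" "b \<in> X - A" "E a b"
  using assms unfolding cut_connected_def by blast

lemma cut_connected_reachable:
  assumes "symp E" and "a \<in> W"
  shows "cut_connected E {v. (a, v) \<in> {(u, v). u \<in> W \<and> v \<in> W \<and> E u v}\<^sup>*}"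
proof -
  let ?R = "{(u, v). u \<in> W \<and> v \<in> W \<and> E u v}"
  let ?Q = "{v. (a, v) \<in> ?R\<^sup>*}"
  have closed: "v \<in> A" if "(a, v) \<in> ?R\<^sup>*" "a \<in> A" "\<forall>u\<in>A. \<forall>w\<in>?Q - A. \<not> E u w" for A v
    using that
  proof (induction rule: rtrancl_induct)
    case base
    then show ?case by simp
  next
    case (step y z)
    have "(a, z) \<in> ?R\<^sup>*"
      using step.hyps by (rule rtrancl_into_rtrancl)
    with step show ?case
      by auto
  qed
  show ?thesis
    unfolding cut_connected_def
  proof (intro conjI allI impI)
    show "?Q \<noteq> {}"
      by auto
  next
    fix A
    assume A: "A \<subset> ?Q" "A \<noteq> {}"
    show "\<exists>u\<in>A. \<exists>w\<in>?Q - A. E u w"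
    proof (rule ccontr)
      assume no: "\<not> (\<exists>u\<in>A. \<exists>w\<in>?Q - A. E u w)"
      show False
      proof (cases "a \<in> A")
        case True
        then have "?Q \<subseteq> A"
          using closed[of _ A] no by blast
        with A show False by blast
      next
        case False
        have "\<forall>u\<in>?Q - A. \<forall>w\<in>?Q - (?Q - A). \<not> E u w"
          using no \<open>symp E\<close> by (auto dest: sympD)
        then have "?Q \<subseteq> ?Q - A"
          using closed[of _ "?Q - A"] False by blast
        with A show False by blast
      qed
    qed
  qed
qed

lemma induce_subgraph_verts_self:
  assumes "wf_digraph G"
  shows "G \<restriction> verts G = G"
proof -
  interpret wf_digraph G by fact
  show ?thesis
    by (auto simp: induce_subgraph_def intro!: pre_digraph.equality)
qed

text \<open>
  Walking from a member of \<open>A\<close> to a member of \<open>X - A\<close>, one leaves \<open>A\<close> along some edge.  By symmetry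
  that edge can be used in the required direction, although connectedness of a digraph ignores
  directions.
\<close>

lemma connected_imp_cut_connected:
  assumes "sym_digraph G" and "connected (G \<restriction> X)"
  shows "cut_connected (dominates G) X"
proof -
  interpret sym_digraph G by fact
  let ?M = "with_proj (mk_symmetric (G \<restriction> X))"
  have reach: "u \<rightarrow>\<^sup>*\<^bsub>?M\<^esub> v" if "u \<in> X" "v \<in> X" for u v
    using assms(2) that unfolding connected_def strongly_connected_def by simp
  have ne: "X \<noteq> {}"
    using assms(2) unfolding connected_def strongly_connected_def by simp
  have adj: "u \<rightarrow>\<^bsub>G\<^esub> v \<and> v \<in> X" if "u \<rightarrow>\<^bsub>?M\<^esub> v" for u v
  proof -
    have "u \<rightarrow>\<^bsub>G\<^esub> v \<or> v \<rightarrow>\<^bsub>G\<^esub> u" "v \<in> X"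
      using that by (auto simp: mk_symmetric_def arcs_ends_def arc_to_ends_def image_iff)
    with graph_symmetric show ?thesis by blast
  qed
  show ?thesis
    unfolding cut_connected_def
  proof (intro conjI allI impI ne)
    fix A
    assume A: "A \<subset> X" "A \<noteq> {}"
    then obtain a b where ab: "a \<in> A" "b \<in> X" "b \<notin> A" by blast
    have "a \<rightarrow>\<^sup>*\<^bsub>?M\<^esub> b"
      using reach ab A by blast
    then have "(a, b) \<in> (arcs_ends ?M)\<^sup>*"
      unfolding reachable_def by (rule rtrancl_on_rtranclI)
    then show "\<exists>u\<in>A. \<exists>w\<in>X - A. u \<rightarrow>\<^bsub>G\<^esub> w"
      using ab(3)
    proof (induction rule: rtrancl_induct)
      case base
      with ab show ?case by simp
    next
      case (step y z)
      with adj show ?case by blast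
    qed
  qed
qed

text \<open>
  Otherwise a path in \<open>S\<close> from \<open>a\<close> to \<open>b\<close>, closed up through \<open>t\<close>, is a cycle; as \<open>a \<noteq> b\<close>, it has length at
  least 3.
\<close>

lemma tree_unique_neighbour:
  assumes "undirected_tree T" and S: "S \<subseteq> verts T" "cut_connected (dominates T) S" and "t \<notin> S"
    and a: "a \<in> S" "a \<rightarrow>\<^bsub>T\<^esub> t" and b: "b \<in> S" "b \<rightarrow>\<^bsub>T\<^esub> t"
  shows "a = b"
proof (rule ccontr)
  assume "a \<noteq> b"
  interpret graph T
    using assms(1) unfolding undirected_tree_def by blast
  interpret S: wf_digraph "T \<restriction> S"
    by (rule wellformed_induce_subgraph)
  let ?A = "{v \<in> S. a \<rightarrow>\<^sup>*\<^bsub>T \<restriction> S\<^esub> v}"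
  have "?A = S"
  proof (rule ccontr)
    assume "?A \<noteq> S"
    then have "?A \<subset> S" "a \<in> ?A"
      using a(1) by auto
    then obtain u w where uw: "u \<in> ?A" "w \<in> S - ?A" "u \<rightarrow>\<^bsub>T\<^esub> w"
      using cut_connectedD[OF S(2)] by blast
    then have "u \<rightarrow>\<^bsub>T \<restriction> S\<^esub> w"
      by (auto simp: arcs_ends_def arc_to_ends_def)
    with uw show False
      using S.reachable_adj_trans by blast
  qed
  with b(1) have "a \<rightarrow>\<^sup>*\<^bsub>T \<restriction> S\<^esub> b" by blast
  then obtain p where p: "S.apath a p b"
    using S.reachable_apath by blast
  have sub: "subgraph (T \<restriction> S) T"
    using S(1) by (rule subgraph_induce_subgraphI)
  have Tp: "apath a p b"
    using subgraph_apath_imp_apath[OF p sub] .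
  have "set (S.awalk_verts a p) \<subseteq> verts (T \<restriction> S)"
    using p unfolding S.apath_def by (blast elim: S.awalkE)
  then have vp: "set (awalk_verts a p) \<subseteq> S"
    by (simp add: awalk_verts_induce)
  obtain e where e: "e \<in> arcs T" "tail T e = t" "head T e = a"
    using a(2) graph_symmetric by blast
  obtain e' where e': "e' \<in> arcs T" "tail T e' = b" "head T e' = t"
    using b(2) by blast
  have ap: "awalk a p b" "distinct (awalk_verts a p)"
    using Tp unfolding apath_def by auto
  have w1: "awalk a (p @ [e']) t"
    using ap e' arc_implies_awalk by force
  then have w: "awalk t (e # p @ [e']) t"
    using e awalk_Cons_iff by auto
  have "awalk_verts a (p @ [e']) = awalk_verts a p @ [t]"
    using awalk_verts_append[OF w1] e' ap(1) by simp
  then have "distinct (tl (awalk_verts t (e # p @ [e'])))"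
    using ap(2) vp \<open>t \<notin> S\<close> e by auto
  then have "cycle (e # p @ [e'])"
    using w unfolding cycle_def by blast
  moreover have "p \<noteq> []"
    using ap(1) \<open>a \<noteq> b\<close> by (auto simp: awalk_Nil_iff)
  then have "length (e # p @ [e']) \<ge> 3"
    by (cases p) auto
  ultimately show False
    using assms(1) unfolding undirected_tree_def by blast
qed

definition helly :: "('a \<Rightarrow> 'a \<Rightarrow> bool) \<Rightarrow> 'a set \<Rightarrow> bool" where
  "helly E S \<longleftrightarrow> (\<forall>F. F \<noteq> {} \<longrightarrow> (\<forall>X\<in>F. X \<subseteq> S \<and> cut_connected E X) \<longrightarrow>
     (\<forall>X\<in>F. \<forall>Y\<in>F. X \<inter> Y \<noteq> {}) \<longrightarrow> \<Inter>F \<noteq> {})"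

lemma hellyD:
  assumes "helly E S" "F \<noteq> {}" "\<forall>X\<in>F. X \<subseteq> S \<and> cut_connected E X"
    "\<forall>X\<in>F. \<forall>Y\<in>F. X \<inter> Y \<noteq> {}"
  shows "\<Inter>F \<noteq> {}"
  using assms(1)[unfolded helly_def, THEN spec, THEN mp, THEN mp, THEN mp, OF assms(2-4)] .

text \<open>
  If the singleton of the leaf \<open>t\<close> belongs to the family, all sets of the family contain \<open>t\<close>.
  Otherwise every set of the family that contains \<open>t\<close> also contains the neighbour \<open>p\<close> of \<open>t\<close>, so
  deleting \<open>t\<close> from all sets preserves both connectedness and pairwise intersection.
\<close>

lemma helly_insert_leaf:
  assumes "symp E" and "helly E S" and "t \<notin> S" and leaf: "\<And>s. s \<in> S \<Longrightarrow> E s t \<Longrightarrow> s = p"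
  shows "helly E (insert t S)"
  unfolding helly_def
proof (intro allI impI)
  fix F
  assume "F \<noteq> {}"
    and F: "\<forall>X\<in>F. X \<subseteq> insert t S \<and> cut_connected E X"
    and meet: "\<forall>X\<in>F. \<forall>Y\<in>F. X \<inter> Y \<noteq> {}"
  show "\<Inter>F \<noteq> {}"
  proof (cases "{t} \<in> F")
    case True
    with meet have "t \<in> \<Inter>F" by blast
    then show ?thesis by blast
  next
    case False
    have p: "p \<in> X - {t}" if X: "X \<in> F" "t \<in> X" for X
    proof -
      have XF: "cut_connected E X" "X \<subseteq> insert t S"
        using F X(1) by auto
      have "{t} \<subset> X"
        using X False by blast
      then obtain b where b: "b \<in> X - {t}" "E t b"
        by (rule cut_connectedD[OF XF(1)]) auto
      then have "b \<in> S" "E b t"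
        using XF(2) sympD[OF \<open>symp E\<close>] by auto
      then have "b = p"
        by (rule leaf)
      with b show ?thesis by simp
    qed
    have conn: "cut_connected E (X - {t})" if X: "X \<in> F" for X
      unfolding cut_connected_def
    proof (intro conjI allI impI)
      have "X \<noteq> {}"
        using bspec[OF F X] cut_connected_nonempty[of E X] by simp
      moreover have "X \<noteq> {t}"
        using False X by auto
      ultimately show "X - {t} \<noteq> {}"
        by auto
    next
      fix A
      assume A: "A \<subset> X - {t}" "A \<noteq> {}"
      have XF: "cut_connected E X" "X \<subseteq> insert t S"
        using F X by auto
      show "\<exists>a\<in>A. \<exists>b\<in>X - {t} - A. E a b"
      proof (cases "p \<in> A \<and> t \<in> X")
        case True
        have "insert t A \<subset> X"
          using A True by blast
        then obtain a b where ab: "a \<in> insert t A" "b \<in> X - insert t A" "E a b"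
          by (rule cut_connectedD[OF XF(1)]) auto
        have "a \<noteq> t"
        proof
          assume "a = t"
          then have "b \<in> S" "E b t"
            using ab XF(2) sympD[OF \<open>symp E\<close>] by auto
          then have "b = p"
            by (rule leaf)
          with ab True show False by blast
        qed
        with ab show ?thesis by blast
      next
        case False
        have "A \<subset> X"
          using A by blast
        then obtain a b where ab: "a \<in> A" "b \<in> X - A" "E a b"
          by (rule cut_connectedD[OF XF(1) _ A(2)])
        have "b \<noteq> t"
        proof
          assume "b = t"
          then have "a \<in> S" "E a t"
            using ab A XF(2) by auto
          then have "a = p"
            by (rule leaf)
          with ab \<open>b = t\<close> False show False by blast
        qed
        with ab show ?thesis by blast
      qed
    qed
    let ?F = "(\<lambda>X. X - {t}) ` F"
    have "?F \<noteq> {}"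
      using \<open>F \<noteq> {}\<close> by blast
    moreover have "\<forall>X\<in>?F. X \<subseteq> S \<and> cut_connected E X"
      using F conn by blast
    moreover have "(X - {t}) \<inter> (Y - {t}) \<noteq> {}" if XY: "X \<in> F" "Y \<in> F" for X Y
    proof (cases "t \<in> X \<inter> Y")
      case True
      with XY have "p \<in> (X - {t}) \<inter> (Y - {t})"
        using p by simp
      then show ?thesis by blast
    next
      case False
      moreover have "X \<inter> Y \<noteq> {}"
        using meet XY by simp
      ultimately show ?thesis by auto
    qed
    then have "\<forall>X\<in>?F. \<forall>Y\<in>?F. X \<inter> Y \<noteq> {}"
      by simp
    ultimately have "\<Inter>?F \<noteq> {}"
      by (rule hellyD[OF \<open>helly E S\<close>])
    then obtain x where "\<forall>X\<in>F. x \<in> X - {t}"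
      using \<open>F \<noteq> {}\<close> by auto
    then show ?thesis
      by auto
  qed
qed

text \<open>
  A tree is built from one node by attaching leaves: a connected proper part has an edge to some
  further node, which has no second neighbour in that part.
\<close>

lemma undirected_tree_helly:
  assumes "undirected_tree T"
  shows "helly (dominates T) (verts T)"
proof -
  interpret graph T
    using assms unfolding undirected_tree_def by blast
  have symE: "symp (dominates T)"
    using graph_symmetric by (auto intro: sympI)
  have "T \<restriction> verts T = T"
    by (rule induce_subgraph_verts_self[OF wf_digraph])
  moreover have "sym_digraph T"
    by unfold_locales
  ultimately have conn: "cut_connected (dominates T) (verts T)"
    using connected_imp_cut_connected[of T "verts T"] assms unfolding undirected_tree_def by simp
  have "\<exists>S\<subseteq>verts T. card S = Suc n \<and> cut_connected (dominates T) S \<and> helly (dominates T) S"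
    if "Suc n \<le> card (verts T)" for n
    using that
  proof (induction n)
    case 0
    obtain t where t: "t \<in> verts T"
      using cut_connected_nonempty[OF conn] by blast
    have "cut_connected (dominates T) {t}"
      unfolding cut_connected_def by blast
    moreover have "t \<in> \<Inter>F" if "\<forall>X\<in>F. X \<subseteq> {t} \<and> cut_connected (dominates T) X" for F
      using that cut_connected_nonempty by fast
    then have "helly (dominates T) {t}"
      unfolding helly_def by blast
    ultimately show ?case
      using t by (intro exI[of _ "{t}"]) auto
  next
    case (Suc n)
    then obtain S where S: "S \<subseteq> verts T" "card S = Suc n" "cut_connected (dominates T) S"
      "helly (dominates T) S"
      by auto
    have "S \<subset> verts T" "S \<noteq> {}"
      using S Suc.prems by auto
    then obtain a t where at: "a \<in> S" "t \<in> verts T - S" "a \<rightarrow>\<^bsub>T\<^esub> t"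
      by (rule cut_connectedD[OF conn])
    have "helly (dominates T) (insert t S)"
      using at tree_unique_neighbour[OF assms S(1,3), of t _ a]
      by (intro helly_insert_leaf[OF symE S(4)]) auto
    moreover have "cut_connected (dominates T) (insert t S)"
      unfolding cut_connected_def
    proof (intro conjI allI impI)
      fix A
      assume A: "A \<subset> insert t S" "A \<noteq> {}"
      show "\<exists>u\<in>A. \<exists>v\<in>insert t S - A. u \<rightarrow>\<^bsub>T\<^esub> v"
      proof (cases "S \<subseteq> A \<or> S \<inter> A = {}")
        case True
        then show ?thesis
          using A at graph_symmetric[of a t] by auto
      next
        case False
        then have "S \<inter> A \<subset> S" "S \<inter> A \<noteq> {}" by auto
        then obtain u v where "u \<in> S \<inter> A" "v \<in> S - S \<inter> A" "u \<rightarrow>\<^bsub>T\<^esub> v"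
          by (rule cut_connectedD[OF S(3)])
        then show ?thesis by blast
      qed
    qed simp
    moreover have "card (insert t S) = Suc (Suc n)"
      using S at finite_subset[OF S(1)] by simp
    ultimately show ?case
      using S(1) at by (intro exI[of _ "insert t S"]) auto
  qed
  moreover have "card (verts T) \<noteq> 0"
    using conn by (auto simp: cut_connected_def)
  ultimately obtain S where "S \<subseteq> verts T" "card S = card (verts T)" "helly (dominates T) S"
    by (metis Suc_pred' bot_nat_0.not_eq_extremum le_refl)
  then show ?thesis
    using card_subset_eq[OF finite_verts] by blast
qed

text \<open>
  The family \<open>\<B>\<close> is a bramble.  The nodes whose bags meet a member of \<open>\<B>\<close> form a connected part of the
  tree, and the parts of two touching members share a node, because some bag contains both ends of
  each edge.  The Helly property yields a node common to all parts.
\<close>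

lemma bramble_covered_by_bag:
  assumes "sym_digraph G" and td: "tree_decomposition G T B"
    and conn: "\<And>X. X \<in> \<B> \<Longrightarrow> X \<subseteq> verts G \<and> cut_connected (dominates G) X"
    and touch: "\<And>X Y. X \<in> \<B> \<Longrightarrow> Y \<in> \<B> \<Longrightarrow> \<exists>x\<in>X. \<exists>y\<in>Y. x = y \<or> x \<rightarrow>\<^bsub>G\<^esub> y"
  shows "\<exists>t\<in>verts T. \<forall>X\<in>\<B>. B t \<inter> X \<noteq> {}"
proof -
  have T: "undirected_tree T" and cover: "(\<Union>t\<in>verts T. B t) = verts G"
    and edge: "\<And>u v. u \<rightarrow>\<^bsub>G\<^esub> v \<Longrightarrow> \<exists>t\<in>verts T. u \<in> B t \<and> v \<in> B t"
    and sub: "\<And>v. v \<in> verts G \<Longrightarrow> connected (T \<restriction> {t \<in> verts T. v \<in> B t})"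
    using td unfolding tree_decomposition_def by auto
  interpret T: graph T
    using T unfolding undirected_tree_def by blast
  define nodes where "nodes X = {t \<in> verts T. B t \<inter> X \<noteq> {}}" for X
  have trace: "cut_connected (dominates T) (nodes {v})" if "v \<in> verts G" for v
  proof -
    have "nodes {v} = {t \<in> verts T. v \<in> B t}"
      by (auto simp: nodes_def)
    moreover have "sym_digraph T"
      by unfold_locales
    ultimately show ?thesis
      using connected_imp_cut_connected[OF _ sub[OF that]] by simp
  qed
  have "cut_connected (dominates T) (nodes X)" if X: "X \<in> \<B>" for X
    unfolding cut_connected_def
  proof (intro conjI allI impI)
    have XG: "X \<subseteq> verts G" "cut_connected (dominates G) X"
      using conn X by auto
    show "nodes X \<noteq> {}"
      using XG(1) cut_connected_nonempty[OF XG(2)] cover unfolding nodes_def by blast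
    fix A
    assume A: "A \<subset> nodes X" "A \<noteq> {}"
    show "\<exists>s\<in>A. \<exists>t\<in>nodes X - A. s \<rightarrow>\<^bsub>T\<^esub> t"
    proof (rule ccontr)
      assume no: "\<not> (\<exists>s\<in>A. \<exists>t\<in>nodes X - A. s \<rightarrow>\<^bsub>T\<^esub> t)"
      have split: "nodes {v} \<subseteq> A \<or> nodes {v} \<inter> A = {}" if v: "v \<in> X" for v
      proof (rule ccontr)
        assume "\<not> ?thesis"
        then have "nodes {v} \<inter> A \<subset> nodes {v}" "nodes {v} \<inter> A \<noteq> {}" by auto
        then obtain s t where "s \<in> nodes {v} \<inter> A" "t \<in> nodes {v} - nodes {v} \<inter> A" "s \<rightarrow>\<^bsub>T\<^esub> t"
          by (rule cut_connectedD[OF trace[OF subsetD[OF XG(1) v]]])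
        moreover have "nodes {v} \<subseteq> nodes X"
          using v by (auto simp: nodes_def)
        ultimately show False
          using no by blast
      qed
      \<comment> \<open>The cut \<open>A\<close> of the node set induces a cut of \<open>X\<close>: no trace of a vertex crosses \<open>A\<close>.\<close>
      let ?X = "{v \<in> X. nodes {v} \<subseteq> A}"
      obtain s t where st: "s \<in> A" "t \<in> nodes X - A"
        using A by blast
      obtain v w where vw: "v \<in> X" "s \<in> nodes {v}" "w \<in> X" "t \<in> nodes {w}"
        using st A unfolding nodes_def by blast
      have "v \<in> ?X" "w \<in> X - ?X"
        using vw split[of v] st by auto
      then have "?X \<subset> X" "?X \<noteq> {}" by auto
      then obtain x y where xy: "x \<in> ?X" "y \<in> X - ?X" "x \<rightarrow>\<^bsub>G\<^esub> y"
        by (rule cut_connectedD[OF XG(2)])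
      then obtain r where "r \<in> verts T" "x \<in> B r" "y \<in> B r"
        using edge by blast
      then have "r \<in> nodes {x} \<inter> nodes {y}"
        by (auto simp: nodes_def)
      then show False
        using xy split[of y] by blast
    qed
  qed
  moreover have "nodes X \<inter> nodes Y \<noteq> {}" if XY: "X \<in> \<B>" "Y \<in> \<B>" for X Y
  proof -
    obtain x y where xy: "x \<in> X" "y \<in> Y" "x = y \<or> x \<rightarrow>\<^bsub>G\<^esub> y"
      using touch[OF XY] by blast
    have "x \<in> verts G"
      using xy conn XY by blast
    then have "\<exists>t\<in>verts T. x \<in> B t \<and> y \<in> B t"
      using xy(3) edge cover by blast
    then show ?thesis
      using xy by (auto simp: nodes_def)
  qed
  ultimately have "\<Inter> (nodes ` \<B>) \<noteq> {}" if "\<B> \<noteq> {}"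
    using that by (intro hellyD[OF undirected_tree_helly[OF T]]) (auto simp: nodes_def)
  then have ?thesis if "\<B> \<noteq> {}"
    using that by (auto simp: nodes_def)
  moreover have "verts T \<noteq> {}"
    using T by (auto simp: undirected_tree_def connected_def strongly_connected_def)
  ultimately show ?thesis
    by blast
qed

section \<open>Hyperbolic disks in the half-plane\<close>

text \<open>
  A hyperbolic disk in the half-plane is a Euclidean disk with its center shifted upwards.  So
  whether two hyperbolic disks meet is decided in the Euclidean plane, by comparing the distance of
  the shifted centers with the sum of the Euclidean radii.
\<close>

lemma hyperbolic_disk_eq:
  assumes "Im c > 0" and "r \<ge> 0"
  shows "hyperbolic_disk c r = cball (Complex (Re c) (Im c * cosh r)) (Im c * sinh r)"
proof (intro set_eqI)
  fix z
  let ?e = "Complex (Re c) (Im c * cosh r)"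
  have sq: "cosh r ^ 2 = 1 + sinh r ^ 2"
    using hyperbolic_pythagoras[of r] by simp
  have cm: "(cmod (c - z))\<^sup>2 = (Re c - Re z)\<^sup>2 + (Im c - Im z)\<^sup>2"
    and ce: "(cmod (?e - z))\<^sup>2 = (Re c - Re z)\<^sup>2 + (Im c * cosh r - Im z)\<^sup>2"
    by (simp_all add: cmod_power2)
  have "dist ?e z \<le> Im c * sinh r \<longleftrightarrow> (cmod (?e - z))\<^sup>2 \<le> (Im c * sinh r)\<^sup>2"
    using assms by (simp add: dist_norm abs_le_square_iff[symmetric])
  also have "\<dots> \<longleftrightarrow> (cmod (c - z))\<^sup>2 \<le> 2 * Im c * Im z * (cosh r - 1)"
    unfolding cm ce power_mult_distrib power2_diff sq by (simp add: algebra_simps)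
  finally have eq: "dist ?e z \<le> Im c * sinh r \<longleftrightarrow> \<dots>" .
  have "Im z > 0" if "dist ?e z \<le> Im c * sinh r"
  proof -
    have "\<bar>Im (?e - z)\<bar> \<le> Im c * sinh r"
      using that abs_Im_le_cmod[of "?e - z"] unfolding dist_norm by linarith
    moreover have "Im c * sinh r < Im c * cosh r"
      using assms sinh_less_cosh_real by simp
    ultimately show ?thesis by simp
  qed
  moreover have "hyperbolic_dist c z \<le> r \<longleftrightarrow> (cmod (c - z))\<^sup>2 \<le> 2 * Im c * Im z * (cosh r - 1)"
    if "Im z > 0"
  proof -
    let ?q = "(cmod (c - z))\<^sup>2 / (2 * Im c * Im z)"
    have "?q \<ge> 0"
      using that assms by simp
    then have "hyperbolic_dist c z \<le> r \<longleftrightarrow> 1 + ?q \<le> cosh r"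
      unfolding hyperbolic_dist_def
      using cosh_real_nonneg_le_iff[of "arcosh (1 + ?q)" r] assms
      by (simp add: cosh_arcosh_real arcosh_nonneg_real)
    also have "\<dots> \<longleftrightarrow> ?q \<le> cosh r - 1"
      by linarith
    finally show ?thesis
      using that assms by (simp add: pos_divide_le_eq mult.commute)
  qed
  ultimately show "z \<in> hyperbolic_disk c r \<longleftrightarrow> z \<in> cball ?e (Im c * sinh r)"
    using eq by (auto simp: hyperbolic_disk_def hyperbolic_plane_def)
qed

lemma cballs_meet_iff:
  fixes a b :: "'a :: real_normed_vector"
  assumes "r \<ge> 0" "s \<ge> 0"
  shows "cball a r \<inter> cball b s \<noteq> {} \<longleftrightarrow> dist a b \<le> r + s"
proof
  assume "cball a r \<inter> cball b s \<noteq> {}"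
  then show "dist a b \<le> r + s"
    using disjoint_cballI[of r s a b] by (meson not_le)
next
  assume le: "dist a b \<le> r + s"
  show "cball a r \<inter> cball b s \<noteq> {}"
  proof (cases "r + s = 0")
    case True
    with le assms have "a = b" "r = 0" "s = 0"
      by auto
    then show ?thesis by simp
  next
    case False
    then have pos: "r + s > 0"
      using assms by linarith
    let ?t = "r / (r + s)"
    let ?z = "a + ?t *\<^sub>R (b - a)"
    have "dist a ?z = ?t * dist a b"
      using assms by (simp add: dist_norm norm_minus_commute)
    also have "\<dots> \<le> r"
      using le assms pos mult_left_mono[of "dist a b" "r + s" ?t] by simp
    finally have "?z \<in> cball a r" by simp
    have "b - ?z = (1 - ?t) *\<^sub>R (b - a)"
      by (simp add: algebra_simps)
    moreover have "1 - ?t = s / (r + s)"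
      using pos by (simp add: field_simps)
    ultimately have "dist b ?z = s / (r + s) * dist a b"
      using assms by (simp add: dist_norm norm_minus_commute)
    also have "\<dots> \<le> s"
      using le assms pos mult_left_mono[of "dist a b" "r + s" "s / (r + s)"] by simp
    finally have "?z \<in> cball b s" by simp
    with \<open>?z \<in> cball a r\<close> show ?thesis by blast
  qed
qed

lemma hyperbolic_disks_meet_iff:
  assumes "Im c > 0" "Im d > 0" "r \<ge> 0"
  shows "hyperbolic_disk c r \<inter> hyperbolic_disk d r \<noteq> {} \<longleftrightarrow>
    (Re c - Re d)\<^sup>2 + (Im c - Im d)\<^sup>2 \<le> 4 * (sinh r)\<^sup>2 * Im c * Im d"
proof -
  let ?c = "Complex (Re c) (Im c * cosh r)" and ?d = "Complex (Re d) (Im d * cosh r)"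
  have sq: "cosh r ^ 2 = 1 + sinh r ^ 2"
    using hyperbolic_pythagoras[of r] by simp
  have "hyperbolic_disk c r \<inter> hyperbolic_disk d r \<noteq> {} \<longleftrightarrow>
    dist ?c ?d \<le> Im c * sinh r + Im d * sinh r"
    using assms by (simp add: hyperbolic_disk_eq cballs_meet_iff)
  also have "\<dots> \<longleftrightarrow> (cmod (?c - ?d))\<^sup>2 \<le> ((Im c + Im d) * sinh r)\<^sup>2"
    using assms by (simp add: dist_norm abs_le_square_iff[symmetric] algebra_simps)
  also have "(cmod (?c - ?d))\<^sup>2 = (Re c - Re d)\<^sup>2 + (Im c - Im d)\<^sup>2 * (cosh r)\<^sup>2"
    by (simp add: cmod_power2 left_diff_distrib[symmetric] power_mult_distrib)
  also have "\<dots> \<le> ((Im c + Im d) * sinh r)\<^sup>2 \<longleftrightarrow>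
    (Re c - Re d)\<^sup>2 + (Im c - Im d)\<^sup>2 \<le> 4 * (sinh r)\<^sup>2 * Im c * Im d"
  proof -
    have "((Im c + Im d) * sinh r)\<^sup>2 = (Im c - Im d)\<^sup>2 * (sinh r)\<^sup>2 + 4 * (sinh r)\<^sup>2 * Im c * Im d"
      by (simp add: power2_eq_square algebra_simps)
    then show ?thesis
      unfolding sq distrib_left by simp
  qed
  finally show ?thesis .
qed

section \<open>Realizing integer ranges by hyperbolic disks\<close>

text \<open>
  Natural numbers serve as vertices, so a point of the line and its level are packed into one number.
  The range \<open>8 ^ (i + j)\<close> is the geometric mean of the heights \<open>64 ^ i\<close> and \<open>64 ^ j\<close>: this is the limit
  of adjacency in the half-plane for large radii.
\<close>

definition pos :: "nat \<Rightarrow> nat" where "pos v = fst (prod_decode v)"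
definition lev :: "nat \<Rightarrow> nat" where "lev v = snd (prod_decode v)"

abbreviation pt :: "nat \<Rightarrow> nat \<Rightarrow> nat" where "pt x j \<equiv> prod_encode (x, j)"

lemma pos_pt [simp]: "pos (pt x j) = x" and lev_pt [simp]: "lev (pt x j) = j"
  by (simp_all add: pos_def lev_def)

lemma pt_pos_lev [simp]: "pt (pos v) (lev v) = v"
  by (simp add: pos_def lev_def)

definition near :: "nat \<Rightarrow> nat \<Rightarrow> bool" where
  "near u v \<longleftrightarrow> pos u \<le> pos v + 8 ^ (lev u + lev v) \<and> pos v \<le> pos u + 8 ^ (lev u + lev v)"

definition window_graph :: "nat set \<Rightarrow> (nat, nat \<times> nat) pre_digraph" where
  "window_graph V = \<lparr>verts = V, arcs = {(u, v). u \<in> V \<and> v \<in> V \<and> u \<noteq> v \<and> near u v},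
     tail = fst, head = snd\<rparr>"

lemma window_graph_simps [simp]:
  "verts (window_graph V) = V"
  "u \<rightarrow>\<^bsub>window_graph V\<^esub> v \<longleftrightarrow> u \<in> V \<and> v \<in> V \<and> u \<noteq> v \<and> near u v"
  by (auto simp: window_graph_def arcs_ends_def arc_to_ends_def image_iff)

lemma near_sym: "near u v \<longleftrightarrow> near v u"
  by (auto simp: near_def add.commute)

lemma graph_window_graph:
  assumes "finite V"
  shows "graph (window_graph V)"
proof
  have "arcs (window_graph V) \<subseteq> V \<times> V"
    by (auto simp: window_graph_def)
  with assms show "finite (arcs (window_graph V))"
    by (meson finite_SigmaI finite_subset)
  show "symmetric (window_graph V)"
    unfolding symmetric_def sym_def using near_sym by auto
qed (use assms in \<open>auto simp: window_graph_def arc_to_ends_def\<close>)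

text \<open>
  A vertex at position \<open>x\<close> and level \<open>j\<close> becomes the point with abscissa \<open>x\<close> and height \<open>t * 64 ^ j\<close>.
  If \<open>t\<close> is small and \<open>4 * (sinh r)\<^sup>2 * t\<^sup>2 = 1 + \<delta>\<close> with \<open>\<delta>\<close> small, the criterion for two disks to
  meet is a perturbation of \<open>(x - y)\<^sup>2 \<le> 64 ^ i * 64 ^ j\<close>: the heights contribute a small square on
  the left, which the surplus \<open>\<delta>\<close> on the right absorbs.  As positions are integers, \<open>\<delta>\<close> can be so
  small that no further pair of disks meets.
\<close>

lemma window_graph_hyperbolic:
  assumes "finite V"
  shows "hyperbolic_uniform_disk_graph (window_graph V)"
proof -
  obtain n where n: "\<And>v. v \<in> V \<Longrightarrow> lev v \<le> n"
    using assms by (metis finite_imageI finite_nat_set_iff_bounded_le imageI)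
  define M :: real where "M = 64 ^ n"
  have M: "M \<ge> 1"
    unfolding M_def by simp
  \<comment> \<open>\<open>M\<close> bounds all \<open>64 ^ j\<close>.  With \<open>\<delta> = 1 / M\<close>, the heights add at most \<open>t\<^sup>2 * M\<^sup>2 \<le> \<delta>\<close>, and the
    surplus \<open>\<delta> * D\<^sup>2 \<le> D\<close> stays below the gap between \<open>D\<^sup>2\<close> and \<open>(D + 1)\<^sup>2\<close> for every range \<open>D \<le> M\<close>.\<close>
  define t where "t = 1 / M\<^sup>2"
  have t: "t > 0"
    using M by (simp add: t_def)
  define r where "r = arsinh (sqrt (1 + 1 / M) / (2 * t))"
  have sinh_r: "4 * (sinh r)\<^sup>2 * t\<^sup>2 = 1 + 1 / M"
    using M t by (simp add: r_def power_divide power_mult_distrib)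
  have r: "r > 0"
    unfolding r_def using M t by (simp add: add_pos_pos)
  define c where "c v = Complex (real (pos v)) (t * 64 ^ lev v)" for v
  have Im_c: "Im (c v) > 0" for v
    using t by (simp add: c_def)
  have "hyperbolic_disk (c u) r \<inter> hyperbolic_disk (c v) r \<noteq> {} \<longleftrightarrow> near u v"
    if V: "u \<in> V" "v \<in> V" for u v
  proof -
    let ?a = "64 ^ lev u :: real" and ?b = "64 ^ lev v :: real"
    define D :: nat where "D = 8 ^ (lev u + lev v)"
    define x where "x = \<bar>int (pos u) - int (pos v)\<bar>"
    have ab: "1 \<le> ?a" "?a \<le> M" "1 \<le> ?b" "?b \<le> M"
      using n V unfolding M_def by (simp_all add: power_increasing)
    have "(64 :: real) ^ m = (8 ^ m)\<^sup>2" for m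
      using power_mult[of "8 :: real" 2 m] power_mult[of "8 :: real" m 2] by (simp add: mult.commute)
    then have D2: "?a * ?b = (real D)\<^sup>2"
      unfolding D_def by (simp add: power_add power_mult_distrib)
    have D: "1 \<le> real D" "real D \<le> M"
    proof -
      show "1 \<le> real D"
        unfolding D_def by simp
      have "(real D)\<^sup>2 \<le> M\<^sup>2"
        using mult_mono[OF ab(2,4)] M by (simp add: D2 power2_eq_square[of M])
      then show "real D \<le> M"
        by (rule power2_le_imp_le) (use M in simp)
    qed
    define \<epsilon> where "\<epsilon> = (t * ?a - t * ?b)\<^sup>2"
    have \<epsilon>: "0 \<le> \<epsilon>" "\<epsilon> \<le> 1 / M"
    proof -
      have "\<bar>?a - ?b\<bar> \<le> M"
        using ab by linarith
      then have "(?a - ?b)\<^sup>2 \<le> M\<^sup>2"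
        using M by (metis abs_le_square_iff abs_of_nonneg order_trans zero_le_one)
      then have "t\<^sup>2 * (?a - ?b)\<^sup>2 \<le> t\<^sup>2 * M\<^sup>2"
        by (intro mult_left_mono) auto
      then have "\<epsilon> \<le> t\<^sup>2 * M\<^sup>2"
        unfolding \<epsilon>_def by (simp add: power_mult_distrib flip: right_diff_distrib)
      also have "\<dots> = (1 / M) * (1 / M)"
        using M by (simp add: t_def power2_eq_square)
      also have "\<dots> \<le> (1 / M) * 1"
        using M by (intro mult_left_mono) auto
      finally show "\<epsilon> \<le> 1 / M" by simp
    qed (simp add: \<epsilon>_def)
    have x2: "(real (pos u) - real (pos v))\<^sup>2 = (real_of_int x)\<^sup>2"
      by (simp add: x_def)
    have "hyperbolic_disk (c u) r \<inter> hyperbolic_disk (c v) r \<noteq> {} \<longleftrightarrow>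
      (real_of_int x)\<^sup>2 + \<epsilon> \<le> (4 * (sinh r)\<^sup>2 * t\<^sup>2) * (?a * ?b)"
    proof -
      have "4 * (sinh r)\<^sup>2 * Im (c u) * Im (c v) = (4 * (sinh r)\<^sup>2 * t\<^sup>2) * (?a * ?b)"
        by (simp add: c_def power2_eq_square)
      moreover have "(Re (c u) - Re (c v))\<^sup>2 + (Im (c u) - Im (c v))\<^sup>2 = (real_of_int x)\<^sup>2 + \<epsilon>"
        by (simp add: c_def \<epsilon>_def x2)
      ultimately show ?thesis
        using hyperbolic_disks_meet_iff[OF Im_c[of u] Im_c[of v] less_imp_le[OF r]] by (simp only:)
    qed
    also have "\<dots> \<longleftrightarrow> (real_of_int x)\<^sup>2 + \<epsilon> \<le> (1 + 1 / M) * (real D)\<^sup>2"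
      by (simp only: sinh_r D2)
    also have "\<dots> \<longleftrightarrow> x \<le> int D"
    proof
      assume "x \<le> int D"
      then have "(real_of_int x)\<^sup>2 \<le> (real D)\<^sup>2"
        by (intro power_mono) (simp_all add: x_def)
      moreover have "1 / M * 1 \<le> 1 / M * (real D)\<^sup>2"
        using D M by (intro mult_left_mono) (auto simp: one_le_power)
      ultimately show "(real_of_int x)\<^sup>2 + \<epsilon> \<le> (1 + 1 / M) * (real D)\<^sup>2"
        using \<epsilon> by (simp add: algebra_simps)
    next
      assume le: "(real_of_int x)\<^sup>2 + \<epsilon> \<le> (1 + 1 / M) * (real D)\<^sup>2"
      show "x \<le> int D"
      proof (rule ccontr)
        assume "\<not> ?thesis"
        then have "real D + 1 \<le> real_of_int x"
          by linarith
        then have "(real D + 1)\<^sup>2 \<le> (real_of_int x)\<^sup>2"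
          by (intro power_mono) auto
        moreover have "1 / M * (real D)\<^sup>2 \<le> real D"
          using D M by (simp add: power2_eq_square divide_le_eq mult_mono)
        ultimately show False
          using le \<epsilon> D by (simp add: power2_eq_square algebra_simps)
      qed
    qed
    also have "\<dots> \<longleftrightarrow> near u v"
      unfolding near_def x_def D_def by linarith
    finally show ?thesis .
  qed
  moreover have "c ` V \<subseteq> hyperbolic_plane"
    using Im_c by (auto simp: hyperbolic_plane_def)
  ultimately show ?thesis
    unfolding hyperbolic_uniform_disk_graph_def
    using graph_window_graph[OF assms] r by (intro conjI exI[of _ r] exI[of _ c]) auto
qed

section \<open>The grid and its bramble\<close>

definition grid :: "nat \<Rightarrow> nat set" where
  "grid k = {v. pos v \<le> 64 ^ k \<and> lev v < k}"

text \<open>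
  Level \<open>2 * k\<close> is high enough for the hub to be near all of the grid, whose width is
  \<open>64 ^ k = 8 ^ (2 * k)\<close>.
\<close>

definition hub :: "nat \<Rightarrow> nat" where
  "hub k = pt 0 (2 * k)"

definition hubbed_grid :: "nat \<Rightarrow> (nat, nat \<times> nat) pre_digraph" where
  "hubbed_grid k = window_graph (insert (hub k) (grid k))"

text \<open>
  The two ends of the grid are not vertical lines, whose points would be pairwise near.  On
  every level they are as wide as the range between points of that level.  This is narrow enough
  for any two connected sets that join the ends to touch (lemma \<open>crossings_touch\<close>).
\<close>

definition left_end :: "nat \<Rightarrow> nat set" where
  "left_end k = {v \<in> grid k. pos v \<le> 64 ^ lev v}"

definition right_end :: "nat \<Rightarrow> nat set" where
  "right_end k = {v \<in> grid k. 64 ^ k \<le> pos v + 64 ^ lev v}"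

definition crossing :: "nat \<Rightarrow> nat set \<Rightarrow> bool" where
  "crossing k X \<longleftrightarrow> X \<subseteq> grid k \<and> cut_connected near X \<and>
     X \<inter> left_end k \<noteq> {} \<and> X \<inter> right_end k \<noteq> {}"

lemma power_64: "(64 :: nat) ^ j = 8 ^ (j + j)"
  using power_mult[of "8 :: nat" 2 j] by (simp add: mult_2)

lemma finite_grid: "finite (grid k)"
proof (rule finite_subset)
  show "grid k \<subseteq> (\<lambda>(x, j). pt x j) ` ({..64 ^ k} \<times> {..<k})"
  proof
    fix v assume "v \<in> grid k"
    then show "v \<in> (\<lambda>(x, j). pt x j) ` ({..64 ^ k} \<times> {..<k})"
      by (intro image_eqI[of _ _ "(pos v, lev v)"]) (auto simp: grid_def)
  qed
qed simp

lemma hub_notin_grid: "hub k \<notin> grid k"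
  by (simp add: grid_def hub_def)

lemma near_hub:
  assumes "v \<in> grid k"
  shows "near v (hub k)"
proof -
  have "pos v \<le> 8 ^ (k + k)"
    using assms by (simp add: grid_def power_64)
  also have "\<dots> \<le> 8 ^ (lev v + 2 * k)"
    by (intro power_increasing) auto
  finally show ?thesis
    by (simp add: near_def hub_def)
qed

text \<open>
  A set that joins the two ends cannot avoid a vertex \<open>p\<close> that is at least as high as the whole set.
  If it has points on both sides of \<open>p\<close>, it has an edge from some \<open>u\<close> on one side to some \<open>w\<close> on the
  other.  Compared with \<open>w\<close>, the vertex \<open>p\<close> is closer to \<open>u\<close> and not lower, so \<open>u\<close> is near \<open>p\<close> as
  well.  If the whole set lies to the left of \<open>p\<close>, then its point in the right end is so close to
  the boundary of the grid that it is near \<open>p\<close>, and likewise with left and right exchanged.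
\<close>

lemma crossing_near_highest:
  assumes X: "crossing k X" and p: "p \<in> grid k" and high: "\<And>q. q \<in> X \<Longrightarrow> lev q \<le> lev p"
  shows "\<exists>q\<in>X. near q p"
proof -
  have XG: "X \<subseteq> grid k" and conn: "cut_connected near X"
    using X by (auto simp: crossing_def)
  have le: "(8 :: nat) ^ (lev a + lev b) \<le> 8 ^ (lev a + lev p)" if "b \<in> X" for a b
    using high[OF that] by (intro power_increasing) auto
  let ?L = "{q \<in> X. pos q \<le> pos p}"
  obtain a where a: "a \<in> X" "pos a \<le> 8 ^ (lev a + lev a)"
    using X by (auto simp: crossing_def left_end_def power_64)
  obtain b where b: "b \<in> X" "64 ^ k \<le> pos b + 8 ^ (lev b + lev b)"
    using X by (auto simp: crossing_def right_end_def power_64)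
  consider "?L = {}" | "?L = X" | "?L \<noteq> {}" "?L \<subset> X"
    by blast
  then show ?thesis
  proof cases
    case 1
    then have "pos p < pos a"
      using a(1) by force
    moreover have "pos a \<le> 8 ^ (lev a + lev p)"
      using a(2) le[OF a(1)] by (rule order_trans)
    ultimately have "near a p"
      by (simp add: near_def)
    with a(1) show ?thesis by blast
  next
    case 2
    then have "pos b \<le> pos p"
      using b(1) by blast
    have "pos p \<le> 64 ^ k"
      using p by (simp add: grid_def)
    then have "pos p \<le> pos b + 8 ^ (lev b + lev p)"
      using b(2) le[OF b(1), of b] by linarith
    with \<open>pos b \<le> pos p\<close> have "near b p"
      by (simp add: near_def)
    with b(1) show ?thesis by blast
  next
    case 3
    then obtain u w where uw: "u \<in> ?L" "w \<in> X - ?L" "near u w"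
      using cut_connectedD[OF conn 3(2,1)] by metis
    then have "pos p \<le> pos w" "pos w \<le> pos u + 8 ^ (lev u + lev w)" "w \<in> X"
      by (auto simp: near_def)
    then have "pos p \<le> pos u + 8 ^ (lev u + lev p)"
      using le[of w u] by linarith
    then have "near u p"
      using uw(1) by (simp add: near_def)
    with uw(1) show ?thesis by blast
  qed
qed

text \<open>
  The highest vertex of the two sets belongs to one of them and cannot be avoided by the other.
\<close>

lemma crossings_touch:
  assumes X: "crossing k X" and Y: "crossing k Y"
  shows "\<exists>x\<in>X. \<exists>y\<in>Y. near x y"
proof -
  have sub: "X \<union> Y \<subseteq> grid k"
    using X Y by (simp add: crossing_def)
  have ne: "X \<union> Y \<noteq> {}"
    using X by (auto simp: crossing_def)
  define m where "m = Max (lev ` (X \<union> Y))"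
  have fin: "finite (lev ` (X \<union> Y))"
    using finite_subset[OF sub finite_grid] by blast
  have "m \<in> lev ` (X \<union> Y)"
    unfolding m_def using fin ne by (intro Max_in) auto
  then obtain p where p: "p \<in> X \<union> Y" "lev p = m"
    by blast
  have high: "lev q \<le> lev p" if "q \<in> X \<union> Y" for q
    unfolding p(2) m_def using fin that by (intro Max_ge) auto
  have "p \<in> grid k"
    using p(1) sub by blast
  then show ?thesis
    using crossing_near_highest[OF X, of p] crossing_near_highest[OF Y, of p] high p(1) near_sym
    by blast
qed

text \<open>
  Let \<open>C\<close> be the part of the grid that can be reached from the left end while avoiding \<open>Z\<close>.  It does
  not meet the right end.  On level \<open>j\<close>, all points within the range \<open>64 ^ j\<close> beyond the last point
  of \<open>C\<close> could be reached from it, so they belong to \<open>Z\<close>.  If \<open>C\<close> has no point on level \<open>j\<close>, then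
  \<open>Z\<close> contains the left end of that level.
\<close>

lemma hitting_set_contains_interval:
  assumes hit: "\<And>X. crossing k X \<Longrightarrow> Z \<inter> X \<noteq> {}" and "j < k"
  shows "\<exists>l. \<forall>x\<in>{l<..l + 64 ^ j}. pt x j \<in> Z \<inter> grid k"
proof -
  define W where "W = grid k - Z"
  define R where "R = {(u, v). u \<in> W \<and> v \<in> W \<and> near u v}"
  define C where "C = {v. \<exists>a\<in>left_end k \<inter> W. (a, v) \<in> R\<^sup>*}"
  have inW: "v \<in> W" if "(a, v) \<in> R\<^sup>*" "a \<in> W" for a v
    using that by (induction rule: rtrancl_induct) (auto simp: R_def)
  have C_right: "C \<inter> right_end k = {}"
  proof (rule ccontr)
    assume "C \<inter> right_end k \<noteq> {}"
    then obtain a v where av: "a \<in> left_end k" "a \<in> W" "(a, v) \<in> R\<^sup>*" "v \<in> right_end k"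
      unfolding C_def by blast
    let ?X = "{u. (a, u) \<in> R\<^sup>*}"
    have "cut_connected near ?X"
      unfolding R_def using av(2) near_sym by (intro cut_connected_reachable) (auto intro: sympI)
    moreover have "?X \<subseteq> W"
      using inW av(2) by blast
    ultimately have "crossing k ?X"
      unfolding crossing_def using av by (auto simp: W_def)
    then show False
      using hit[of ?X] \<open>?X \<subseteq> W\<close> by (auto simp: W_def)
  qed
  have CW: "C \<subseteq> W"
    using inW by (auto simp: C_def)
  have C_step: "v \<in> C" if "u \<in> C" "v \<in> W" "near u v" for u v
  proof -
    obtain a where a: "a \<in> left_end k" "a \<in> W" "(a, u) \<in> R\<^sup>*"
      using \<open>u \<in> C\<close> by (auto simp: C_def)
    have "(u, v) \<in> R"
      using that CW by (auto simp: R_def)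
    with a show ?thesis
      unfolding C_def by (auto intro: rtrancl_into_rtrancl)
  qed
  let ?row = "{x. pt x j \<in> C}"
  have row: "?row \<subseteq> {..64 ^ k}"
    using CW by (auto simp: W_def grid_def)
  have jk: "(64 :: nat) ^ j \<le> 64 ^ k"
    using \<open>j < k\<close> by (intro power_increasing) auto
  show ?thesis
  proof (cases "?row = {}")
    case True
    have "pt x j \<in> Z \<inter> grid k" if "x \<le> 64 ^ j" for x
    proof -
      have "x \<le> 64 ^ k"
        using that jk by (rule order_trans)
      then have G: "pt x j \<in> left_end k" "pt x j \<in> grid k"
        using that \<open>j < k\<close> by (auto simp: left_end_def grid_def)
      then have "pt x j \<in> C" if "pt x j \<in> W"
        using that by (auto simp: C_def)
      with True G show ?thesis
        by (auto simp: W_def)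
    qed
    then show ?thesis
      by (intro exI[of _ 0]) auto
  next
    case False
    define l where "l = Max ?row"
    have fin: "finite ?row"
      using row by (rule finite_subset) simp
    have l: "pt l j \<in> C"
      using Max_in[OF fin False] by (simp add: l_def)
    then have "pt l j \<in> grid k" "pt l j \<notin> right_end k"
      using CW C_right by (auto simp: W_def)
    then have end_l: "l + 64 ^ j < 64 ^ k"
      by (auto simp: right_end_def)
    have "pt x j \<in> Z \<inter> grid k" if x: "x \<in> {l<..l + 64 ^ j}" for x
    proof -
      have G: "pt x j \<in> grid k"
        using x end_l \<open>j < k\<close> by (auto simp: grid_def)
      have "near (pt l j) (pt x j)"
        using x by (auto simp: near_def power_64)
      then have "pt x j \<in> C" if "pt x j \<in> W"
        using C_step[OF l that] by blast
      moreover have "pt x j \<notin> C"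
        using Max_ge[OF fin, of x] x by (auto simp: l_def)
      ultimately show ?thesis
        using G by (auto simp: W_def)
    qed
    then show ?thesis by blast
  qed
qed

section \<open>A large independent set in some bag\<close>

text \<open>
  The windows that points on the levels below \<open>j\<close> forbid on level \<open>j\<close> are, taken together, smaller
  than an interval of length \<open>64 ^ j\<close>.  This is where the growth of the heights by the factor 64 per
  level matters: the sum of the windows is dominated by a geometric series of ratio 8.
\<close>

lemma sum_windows_less: "(\<Sum>i<j. 2 * 8 ^ (i + j) + 1) < (64 :: nat) ^ j"
proof -
  have geo: "7 * (\<Sum>i<n. 8 ^ i) + 1 = (8 :: nat) ^ n" for n
    by (induction n) auto
  have "7 * (\<Sum>i<j. 2 * 8 ^ (i + j) + 1) = 2 * 8 ^ j * (7 * (\<Sum>i<j. 8 ^ i)) + 7 * j"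
    by (simp add: sum.distrib power_add sum_distrib_left mult_ac)
  also have "\<dots> < 7 * (8 ^ j * 8 ^ j)"
  proof -
    have "2 * 8 ^ j * (7 * (\<Sum>i<j. 8 ^ i)) + 2 * 8 ^ j = 2 * 8 ^ j * (7 * (\<Sum>i<j. 8 ^ i) + 1 :: nat)"
      by (simp only: distrib_left mult_1_right)
    also have "\<dots> = 2 * (8 ^ j * 8 ^ j)"
      by (simp only: geo mult.assoc)
    finally have "2 * 8 ^ j * (7 * (\<Sum>i<j. 8 ^ i)) + 2 * 8 ^ j = 2 * (8 ^ j * (8 :: nat) ^ j)" .
    moreover have "j < (8 :: nat) ^ j"
      by (rule power_gt_expt) simp
    moreover have "(8 :: nat) ^ j \<le> 8 ^ j * 8 ^ j"
      by simp
    ultimately show ?thesis by linarith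
  qed
  finally show ?thesis
    by (simp add: power_64 power_add)
qed

text \<open>
  The points are chosen greedily from the lowest level upwards: by the previous lemma, the windows
  around the points chosen so far cannot cover the interval of the next level.
\<close>

lemma far_choice:
  fixes l :: "nat \<Rightarrow> nat"
  shows "\<exists>p. (\<forall>j<k. p j \<in> {l j<..l j + 64 ^ j}) \<and> (\<forall>j<k. \<forall>i<j. \<not> near (pt (p i) i) (pt (p j) j))"
proof (induction k)
  case 0
  then show ?case by simp
next
  case (Suc k)
  then obtain p where p: "\<And>j. j < k \<Longrightarrow> p j \<in> {l j<..l j + 64 ^ j}"
    "\<And>i j. j < k \<Longrightarrow> i < j \<Longrightarrow> \<not> near (pt (p i) i) (pt (p j) j)"
    by blast
  let ?window = "\<lambda>i. {p i - 8 ^ (i + k)..p i + 8 ^ (i + k)}"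
  have "card (\<Union>i<k. ?window i) \<le> (\<Sum>i<k. card (?window i))"
    by (intro card_UN_le) simp
  also have "\<dots> \<le> (\<Sum>i<k. 2 * 8 ^ (i + k) + 1)"
    by (intro sum_mono) auto
  also have "\<dots> < card {l k<..l k + 64 ^ k}"
    using sum_windows_less[of k] by simp
  finally have "\<not> {l k<..l k + 64 ^ k} \<subseteq> (\<Union>i<k. ?window i)"
    by (meson card_mono finite_UN_I finite_atLeastAtMost finite_lessThan not_le)
  then obtain x where x: "x \<in> {l k<..l k + 64 ^ k}" "\<And>i. i < k \<Longrightarrow> x \<notin> ?window i"
    by blast
  have far: "\<not> near (pt (p i) i) (pt x k)" if "i < k" for i
    using x(2)[OF that] by (auto simp: near_def)
  show ?case
  proof (intro exI[of _ "p(k := x)"] conjI allI impI)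
    fix j assume "j < Suc k"
    then show "(p(k := x)) j \<in> {l j<..l j + 64 ^ j}"
      using p(1)[of j] x(1) by (cases "j = k") auto
  next
    fix j i assume "j < Suc k" "i < j"
    then show "\<not> near (pt ((p(k := x)) i) i) (pt ((p(k := x)) j) j)"
      using p(2)[of j i] far[of i] by (cases "j = k") auto
  qed
qed

lemma graph_hubbed_grid: "graph (hubbed_grid k)"
  unfolding hubbed_grid_def by (intro graph_window_graph) (simp add: finite_grid)

lemma verts_hubbed_grid: "verts (hubbed_grid k) = insert (hub k) (grid k)"
  by (simp add: hubbed_grid_def)

text \<open>
  Some bag meets all sets that join the two ends of the grid, hence contains an interval on every
  level, and mutually far points can be picked from these intervals.
\<close>

lemma bag_with_large_independent_set:
  assumes td: "tree_decomposition (hubbed_grid k) T B"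
  shows "\<exists>t\<in>verts T. \<exists>S\<subseteq>B t. card S = k \<and> (\<forall>u\<in>S. \<forall>v\<in>S. \<not> u \<rightarrow>\<^bsub>hubbed_grid k\<^esub> v)"
proof -
  interpret graph "hubbed_grid k"
    by (rule graph_hubbed_grid)
  have adj: "u \<rightarrow>\<^bsub>hubbed_grid k\<^esub> v \<longleftrightarrow> u \<noteq> v \<and> near u v" if "u \<in> grid k" "v \<in> grid k" for u v
    using that by (auto simp: hubbed_grid_def)
  have "\<exists>t\<in>verts T. \<forall>X\<in>Collect (crossing k). B t \<inter> X \<noteq> {}"
  proof (rule bramble_covered_by_bag[OF _ td])
    show "sym_digraph (hubbed_grid k)"
      by unfold_locales
  next
    fix X assume "X \<in> Collect (crossing k)"
    then have X: "X \<subseteq> grid k" "cut_connected near X"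
      by (auto simp: crossing_def)
    have "cut_connected (dominates (hubbed_grid k)) X"
      unfolding cut_connected_def
    proof (intro conjI allI impI cut_connected_nonempty[OF X(2)])
      fix A assume A: "A \<subset> X" "A \<noteq> {}"
      then obtain a b where ab: "a \<in> A" "b \<in> X - A" "near a b"
        by (rule cut_connectedD[OF X(2)])
      then have "a \<rightarrow>\<^bsub>hubbed_grid k\<^esub> b"
        using adj[of a b] A X(1) by blast
      with ab show "\<exists>a\<in>A. \<exists>b\<in>X - A. a \<rightarrow>\<^bsub>hubbed_grid k\<^esub> b"
        by blast
    qed
    with X show "X \<subseteq> verts (hubbed_grid k) \<and> cut_connected (dominates (hubbed_grid k)) X"
      by (auto simp: verts_hubbed_grid)
  next
    fix X Y assume XY: "X \<in> Collect (crossing k)" "Y \<in> Collect (crossing k)"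
    then obtain x y where "x \<in> X" "y \<in> Y" "near x y"
      using crossings_touch by blast
    moreover have "x \<in> grid k" "y \<in> grid k"
      using XY calculation by (auto simp: crossing_def)
    ultimately show "\<exists>x\<in>X. \<exists>y\<in>Y. x = y \<or> x \<rightarrow>\<^bsub>hubbed_grid k\<^esub> y"
      using adj by blast
  qed
  then obtain t where t: "t \<in> verts T" "\<And>X. crossing k X \<Longrightarrow> B t \<inter> X \<noteq> {}"
    by blast
  obtain l where l: "\<And>j x. j < k \<Longrightarrow> x \<in> {l j<..l j + 64 ^ j} \<Longrightarrow> pt x j \<in> B t \<inter> grid k"
    using hitting_set_contains_interval[of k "B t", OF t(2)] by metis
  obtain p where p: "\<And>j. j < k \<Longrightarrow> p j \<in> {l j<..l j + 64 ^ j}"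
    "\<And>i j. j < k \<Longrightarrow> i < j \<Longrightarrow> \<not> near (pt (p i) i) (pt (p j) j)"
    using far_choice[of k l] by blast
  define s where "s j = pt (p j) j" for j
  have "inj_on s {..<k}"
    by (auto simp: inj_on_def s_def)
  then have "card (s ` {..<k}) = k"
    by (simp add: card_image)
  moreover have sub: "s ` {..<k} \<subseteq> B t \<inter> grid k"
    using l p(1) by (auto simp: s_def)
  moreover have "\<not> s i \<rightarrow>\<^bsub>hubbed_grid k\<^esub> s j" if "i < k" "j < k" for i j
  proof -
    have "s i \<in> grid k" "s j \<in> grid k"
      using sub that by auto
    moreover have "i = j \<or> \<not> near (s i) (s j)"
      using p(2)[of j i] p(2)[of i j] that near_sym by (metis linorder_neqE_nat s_def)
    ultimately show ?thesis
      using adj by blast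
  qed
  ultimately show ?thesis
    using t(1) by (intro bexI[of _ t] exI[of _ "s ` {..<k}"]) auto
qed

section \<open>The two parameters\<close>

lemma independence_number_ge:
  assumes "finite X" "S \<subseteq> X" "\<And>u v. u \<in> S \<Longrightarrow> v \<in> S \<Longrightarrow> \<not> u \<rightarrow>\<^bsub>G\<^esub> v"
  shows "card S \<le> independence_number G X"
  unfolding independence_number_def
proof (rule Max_ge)
  have "{card S | S. independent_set (G \<restriction> X) S} \<subseteq> card ` Pow X"
    by (auto simp: independent_set_def)
  then show "finite {card S | S. independent_set (G \<restriction> X) S}"
    using assms(1) by (meson finite_Pow_iff finite_imageI finite_subset)
  have "independent_set (G \<restriction> X) S"
    using assms(2,3) by (auto simp: independent_set_def arcs_ends_def arc_to_ends_def)
  then show "card S \<in> {card S | S. independent_set (G \<restriction> X) S}"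
    by blast
qed

definition one_node :: "(nat, nat \<times> nat) pre_digraph" where
  "one_node = \<lparr>verts = {0}, arcs = {}, tail = fst, head = snd\<rparr>"

text \<open>
  Some tree decomposition exists, so the infimum and the least element in the definitions of the
  two parameters are attained.
\<close>

lemma one_bag_decomposition:
  assumes "wf_digraph G"
  shows "tree_decomposition G one_node (\<lambda>_. verts G)"
proof -
  interpret wf_digraph G by fact
  have vertex: "verts one_node = {0}"
    by (simp add: one_node_def)
  have conn: "connected one_node"
    by (auto simp: connected_def strongly_connected_def one_node_def mk_symmetric_def reachable_def)
  moreover have "graph one_node"
    by unfold_locales (auto simp: one_node_def symmetric_def sym_def arcs_ends_def)
  moreover have "length p < 3" if "pre_digraph.cycle one_node p" for p
    using that by (auto simp: pre_digraph.cycle_def pre_digraph.awalk_def one_node_def)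
  ultimately have "undirected_tree one_node"
    unfolding undirected_tree_def by fastforce
  moreover have "one_node \<restriction> {0} = one_node"
    by (auto simp: one_node_def induce_subgraph_def)
  ultimately show ?thesis
    using conn unfolding tree_decomposition_def
    by (auto dest: adj_in_verts simp: vertex)
qed

lemma tree_independence_number_hubbed_grid: "k \<le> tree_independence_number (hubbed_grid k)"
proof -
  interpret graph "hubbed_grid k"
    by (rule graph_hubbed_grid)
  let ?A = "{Max ((\<lambda>t. independence_number (hubbed_grid k) (B t)) ` verts T) |
    (T :: (nat, nat \<times> nat) pre_digraph) B. tree_decomposition (hubbed_grid k) T B}"
  have "?A \<noteq> {}"
    using one_bag_decomposition[OF wf_digraph] by blast
  then have "Inf ?A \<in> ?A"
    by (rule Inf_nat_def1)
  then obtain T :: "(nat, nat \<times> nat) pre_digraph" and B where TB: "tree_decomposition (hubbed_grid k) T B"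
    and eq: "tree_independence_number (hubbed_grid k) =
      Max ((\<lambda>t. independence_number (hubbed_grid k) (B t)) ` verts T)"
    unfolding tree_independence_number_def by blast
  obtain t S where t: "t \<in> verts T" and S: "S \<subseteq> B t" "card S = k"
    "\<forall>u\<in>S. \<forall>v\<in>S. \<not> u \<rightarrow>\<^bsub>hubbed_grid k\<^esub> v"
    using bag_with_large_independent_set[OF TB] by blast
  have "B t \<subseteq> verts (hubbed_grid k)"
    using TB t by (auto simp: tree_decomposition_def)
  then have "finite (B t)"
    by (rule finite_subset) simp
  then have "k \<le> independence_number (hubbed_grid k) (B t)"
    using independence_number_ge[OF _ S(1)] S(2,3) by metis
  also have "\<dots> \<le> tree_independence_number (hubbed_grid k)"
  proof -
    have "finite (verts T)"
      using TB fin_digraph.finite_verts graph.axioms digraph.axioms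
      unfolding tree_decomposition_def undirected_tree_def by blast
    then show ?thesis
      unfolding eq using t by (intro Max_ge) auto
  qed
  finally show ?thesis .
qed

lemma hub_adjacent:
  assumes "v \<in> grid k"
  shows "hub k \<rightarrow>\<^bsub>hubbed_grid k\<^esub> v"
  using assms near_hub[OF assms] near_sym hub_notin_grid by (auto simp: hubbed_grid_def)

lemma graph_ball_hub: "graph_ball (hubbed_grid k) (hub k) 1 = verts (hubbed_grid k)"
proof -
  interpret graph "hubbed_grid k"
    by (rule graph_hubbed_grid)
  have hub: "hub k \<in> verts (hubbed_grid k)"
    by (simp add: verts_hubbed_grid)
  have "graph_dist (hubbed_grid k) (hub k) v \<le> 1" if v: "v \<in> verts (hubbed_grid k)" for v
  proof -
    have "\<exists>p. awalk (hub k) p v \<and> length p \<le> 1"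
    proof (cases "v = hub k")
      case True
      with hub show ?thesis
        by (intro exI[of _ "[]"]) (simp add: awalk_Nil_iff)
    next
      case False
      then have "hub k \<rightarrow>\<^bsub>hubbed_grid k\<^esub> v"
        using v hub_adjacent by (auto simp: verts_hubbed_grid)
      then obtain e where "e \<in> arcs (hubbed_grid k)" "tail (hubbed_grid k) e = hub k"
        "head (hubbed_grid k) e = v"
        by blast
      then show ?thesis
        using arc_implies_awalk[of e] by (intro exI[of _ "[e]"]) simp
    qed
    then obtain p where p: "awalk (hub k) p v" "length p \<le> 1"
      by blast
    have "graph_dist (hubbed_grid k) (hub k) v \<le> ereal (awalk_cost (\<lambda>_. 1) p)"
      unfolding graph_dist_def using p(1) by (rule min_cost_le_walk_cost)
    also have "\<dots> = ereal (real (length p))"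
      by (simp add: awalk_cost_def sum_list_triv)
    also have "\<dots> \<le> 1"
      using p(2) by simp
    finally show ?thesis .
  qed
  then show ?thesis
    by (auto simp: graph_ball_def simp flip: one_ereal_def)
qed

text \<open>
  The hub lies in one layer, so its neighbours, that is, all other vertices, lie in this layer and
  the two next to it.  One of these three layers receives a third of the large independent set in
  the bag.
\<close>

lemma layered_tree_independence_number_hubbed_grid:
  "k \<le> 3 * layered_tree_independence_number (hubbed_grid k)"
proof -
  let ?G = "hubbed_grid k"
  interpret graph ?G
    by (rule graph_hubbed_grid)
  let ?P = "\<lambda>l. \<exists>(T :: (nat, nat \<times> nat) pre_digraph) B L. tree_decomposition ?G T B \<and>
    layering ?G L \<and> (\<forall>t\<in>verts T. \<forall>i. independence_number ?G (B t \<inter> L i) \<le> l)"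
  define c where "c = layered_tree_independence_number ?G"
  let ?L = "\<lambda>i :: nat. if i = 0 then verts ?G else {}"
  have "layering ?G ?L"
    unfolding layering_def by (auto split: if_splits)
  moreover have "independence_number ?G (verts ?G \<inter> ?L i) \<le>
    independence_number ?G (verts ?G) + independence_number ?G {}" for i
    by simp
  ultimately have "?P (independence_number ?G (verts ?G) + independence_number ?G {})"
    using one_bag_decomposition[OF wf_digraph] by blast
  then have "?P c"
    unfolding c_def layered_tree_independence_number_def by (rule LeastI)
  then obtain T :: "(nat, nat \<times> nat) pre_digraph" and B L where TB: "tree_decomposition ?G T B"
    and L: "layering ?G L"
    and c: "\<And>t i. t \<in> verts T \<Longrightarrow> independence_number ?G (B t \<inter> L i) \<le> c"
    by blast
  obtain t S where t: "t \<in> verts T" and S: "S \<subseteq> B t" "card S = k"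
    "\<forall>u\<in>S. \<forall>v\<in>S. \<not> u \<rightarrow>\<^bsub>?G\<^esub> v"
    using bag_with_large_independent_set[OF TB] by blast
  have "B t \<subseteq> verts ?G"
    using TB t by (auto simp: tree_decomposition_def)
  then have fin: "finite (B t)"
    by (rule finite_subset) simp
  have part: "card (S \<inter> L i) \<le> c" for i
  proof -
    have "card (S \<inter> L i) \<le> independence_number ?G (B t \<inter> L i)"
      using S fin by (intro independence_number_ge) auto
    with c[OF t, of i] show ?thesis by simp
  qed
  have cover: "(\<Union>i. L i) = verts ?G"
    and step: "\<And>u v i j. u \<rightarrow>\<^bsub>?G\<^esub> v \<Longrightarrow> u \<in> L i \<Longrightarrow> v \<in> L j \<Longrightarrow> i = j \<or> i = Suc j \<or> j = Suc i"
    using L unfolding layering_def by blast+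
  obtain m where m: "hub k \<in> L m"
    using cover verts_hubbed_grid by blast
  have "S \<subseteq> (S \<inter> L m) \<union> (S \<inter> L (m - 1)) \<union> (S \<inter> L (Suc m))"
  proof
    fix v assume v: "v \<in> S"
    then have "v \<in> verts ?G"
      using S(1) \<open>B t \<subseteq> verts ?G\<close> by blast
    then obtain j where j: "v \<in> L j"
      using cover by blast
    have "v = hub k \<or> m = j \<or> m = Suc j \<or> j = Suc m"
      using step[OF hub_adjacent m j] \<open>v \<in> verts ?G\<close> by (auto simp: verts_hubbed_grid)
    then show "v \<in> (S \<inter> L m) \<union> (S \<inter> L (m - 1)) \<union> (S \<inter> L (Suc m))"
      using v j m by auto
  qed
  moreover have "finite S"
    using finite_subset[OF S(1) fin] .
  ultimately have "card S \<le> card ((S \<inter> L m) \<union> (S \<inter> L (m - 1)) \<union> (S \<inter> L (Suc m)))"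
    by (intro card_mono) auto
  also have "\<dots> \<le> card (S \<inter> L m) + card (S \<inter> L (m - 1)) + card (S \<inter> L (Suc m))"
    by (meson add_le_mono1 card_Un_le order_trans)
  also have "\<dots> \<le> 3 * c"
    using part[of m] part[of "m - 1"] part[of "Suc m"] by linarith
  finally show ?thesis
    using S(2) by (simp add: c_def)
qed

lemma hubbed_grid_hyperbolic: "hyperbolic_uniform_disk_graph (hubbed_grid k)"
  unfolding hubbed_grid_def by (intro window_graph_hyperbolic) (simp add: finite_grid)

theorem corollary5:
  shows "(\<not> (\<exists>f :: nat \<Rightarrow> nat. \<forall>G :: (nat, nat \<times> nat) pre_digraph.
             hyperbolic_uniform_disk_graph G \<longrightarrow>
             (\<forall>v\<in>verts G. \<forall>t :: nat.
                tree_independence_number (G \<restriction> graph_ball G v t) \<le> f t))) \<and>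
         (\<not> (\<exists>c :: nat. \<forall>G :: (nat, nat \<times> nat) pre_digraph.
             hyperbolic_uniform_disk_graph G \<longrightarrow>
             layered_tree_independence_number G \<le> c))"
proof (intro conjI notI)
  assume "\<exists>f :: nat \<Rightarrow> nat. \<forall>G :: (nat, nat \<times> nat) pre_digraph.
    hyperbolic_uniform_disk_graph G \<longrightarrow>
    (\<forall>v\<in>verts G. \<forall>t :: nat. tree_independence_number (G \<restriction> graph_ball G v t) \<le> f t)"
  then obtain f :: "nat \<Rightarrow> nat" where f: "\<And>(G :: (nat, nat \<times> nat) pre_digraph) v t.
    hyperbolic_uniform_disk_graph G \<Longrightarrow> v \<in> verts G \<Longrightarrow>
    tree_independence_number (G \<restriction> graph_ball G v t) \<le> f t"
    by blast
  let ?G = "hubbed_grid (Suc (f 1))"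
  interpret graph ?G
    by (rule graph_hubbed_grid)
  have "?G \<restriction> graph_ball ?G (hub (Suc (f 1))) 1 = ?G"
    unfolding graph_ball_hub by (rule induce_subgraph_verts_self[OF wf_digraph])
  moreover have "hub (Suc (f 1)) \<in> verts ?G"
    by (simp add: verts_hubbed_grid)
  ultimately have "tree_independence_number ?G \<le> f 1"
    using f[OF hubbed_grid_hyperbolic, of "hub (Suc (f 1))" "Suc (f 1)" 1] by simp
  with tree_independence_number_hubbed_grid[of "Suc (f 1)"] show False
    by simp
next
  assume "\<exists>c :: nat. \<forall>G :: (nat, nat \<times> nat) pre_digraph.
    hyperbolic_uniform_disk_graph G \<longrightarrow> layered_tree_independence_number G \<le> c"
  then obtain c where "layered_tree_independence_number (hubbed_grid (3 * c + 1)) \<le> c"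
    using hubbed_grid_hyperbolic by blast
  with layered_tree_independence_number_hubbed_grid[of "3 * c + 1"] show False
    by simp
qed

end
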